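(* Let $V$ be a complex vector space of dimension $n\geq 1$ and let $\rho$ be the representation of $\mathfrak{gl}(V)$ on the space of symmetric forms $S^2(V)$ corresponding to the congruence action. Then the Jordan--Kronecker invariants of $\rho$ are: - $n$ Jordan $1\times1$ blocks with different eigenvalues; - $\frac{n(n-1)}{2}$ horizontal indices $\mathrm{h}_i=2$ (and there are no other blocks).
   Context: Everything is over $\mathbb{C}$ and finite-dimensional. Pencils. For linear maps $A,B:U\to V$ there are bases of $U$ and $V$ (Kronecker's theorem) in which all matrices $A+\lambda B$ are simultaneously block-diagonal, each pair of diagonal blocks $(A_i,B_i)$ being one of: (i) a $k\times k$ Jordan block with eigenvalue $\lambda_0\in\mathbb{C}$: $A_i=J_k(\lambda_0)$ (the upper triangular Jordan block), $B_i=I_k$; (ii) a $k\times k$ Jordan block with eigenvalue $\infty$: $A_i=I_k$, $B_i=J_k(0)$; (iii) a horizontal Kronecker block of size $(h-1)\times h$, $h\ge 1$: $A_i=(0\,|\,I_{h-1})$, $B_i=(I_{h-1}\,|\,0)$; (iv) a vertical Kronecker block of size $v\times(v-1)$, $v\ge1$: the transposes of the matrices in (iii) with $h=v$. A $0\times 1$ horizontal block ($h=1$) is a zero column and a $1\times 0$ vertical block ($v=1$) is a zero row. The blocks are unique up to permutation. The numbers $h$ (widths of horizontal blocks) are the horizontal indices, the numbers $v$ (heights of vertical blocks) are the vertical indices. Representations. For a representation $\rho:\mathfrak{g}\to\mathfrak{gl}(W)$ and $x\in W$ put $R_x:\mathfrak{g}\to W$, $R_x(\xi)=\rho(\xi)x$.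 The algebraic type of the pencil $R_a+\lambda R_b=R_{a+\lambda b}$ is the collection: number of distinct eigenvalues of Jordan blocks, number and sizes of the Jordan blocks for each eigenvalue, horizontal and vertical indices (with multiplicity). The Jordan--Kronecker (JK) invariants of $\rho$ are the algebraic type of $R_{a+\lambda b}$ for a generic pair $(a,b)\in W\times W$ (i.e. for all pairs in some non-empty Zariski open subset). Congruence action. In a fixed basis of $V$, the group $\mathrm{GL}(V)$ acts on bilinear forms (square matrices $Q$) by $(P,Q)\mapsto PQP^T$; the corresponding Lie algebra representation is $\rho(X)Q=XQ+QX^T$. Here it is restricted to symmetric matrices $Q\in S^2(V)$. *)

theory Defs
  imports
    "HOL-Analysis.Analysis"
    "HOL-Library.Multiset"
    "Jordan_Normal_Form.Jordan_Normal_Form"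
begin

text \<open>
  Both Analysis and Jordan_Normal_Form define vectors and matrices.  Here the vector spaces
  \<open>gl(V)\<close> and \<open>S\<^sup>2(V)\<close> live in the type \<^typ>\<open>complex^'n^'n\<close>, whereas \<^typ>\<open>complex mat\<close>, whose
  dimensions are not part of the type, is used for the matrices representing linear maps.
\<close>

no_notation Matrix.vec_index (infixl \<open>$\<close> 100)

section \<open>Kronecker canonical form of a pencil of linear maps\<close>

datatype pencil_eigenvalue = Finite complex | Infinity

text \<open>
  The parameter of a horizontal block is its width, that of a vertical block its height.
\<close>

datatype kblock = Jordan pencil_eigenvalue nat | Horizontal nat | Vertical nat

fun valid_block :: "kblock \<Rightarrow> bool" where
  "valid_block (Jordan e k) \<longleftrightarrow> 1 \<le> k"
| "valid_block (Horizontal h) \<longleftrightarrow> 1 \<le> h"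
| "valid_block (Vertical v) \<longleftrightarrow> 1 \<le> v"

text \<open>The \<open>(h - 1) \<times> h\<close> matrices \<open>(0 | I)\<close> and \<open>(I | 0)\<close>.\<close>

definition zero_one_block :: "nat \<Rightarrow> complex mat" where
  "zero_one_block h = Matrix.mat (h - 1) h (\<lambda>(i, j). if j = Suc i then 1 else 0)"

definition one_zero_block :: "nat \<Rightarrow> complex mat" where
  "one_zero_block h = Matrix.mat (h - 1) h (\<lambda>(i, j). if j = i then 1 else 0)"

fun block_A :: "kblock \<Rightarrow> complex mat" where
  "block_A (Jordan (Finite c) k) = jordan_block k c"
| "block_A (Jordan Infinity k) = 1\<^sub>m k"
| "block_A (Horizontal h) = zero_one_block h"
| "block_A (Vertical v) = transpose_mat (zero_one_block v)"

fun block_B :: "kblock \<Rightarrow> complex mat" where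
  "block_B (Jordan (Finite c) k) = 1\<^sub>m k"
| "block_B (Jordan Infinity k) = jordan_block k 0"
| "block_B (Horizontal h) = one_zero_block h"
| "block_B (Vertical v) = transpose_mat (one_zero_block v)"

text \<open>
  A vector space is given by a scalar multiplication \<open>s\<close> on an additive group together with a
  subspace of it.
\<close>

definition ordered_basis ::
  "(complex \<Rightarrow> 'a::ab_group_add \<Rightarrow> 'a) \<Rightarrow> 'a set \<Rightarrow> 'a list \<Rightarrow> bool" where
  "ordered_basis s U us \<longleftrightarrow>
     distinct us \<and> \<not> module.dependent s (set us) \<and> module.span s (set us) = U"

definition represented_by ::
  "(complex \<Rightarrow> 'b::ab_group_add \<Rightarrow> 'b) \<Rightarrow> 'a list \<Rightarrow> 'b list \<Rightarrow> ('a \<Rightarrow> 'b) \<Rightarrow> complex mat \<Rightarrow> bool"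
where
  "represented_by s us ws f M \<longleftrightarrow>
     M \<in> carrier_mat (length ws) (length us) \<and>
     (\<forall>j < length us. f (us ! j) = (\<Sum>i < length ws. s (M $$ (i, j)) (ws ! i)))"

definition has_kronecker_form ::
  "(complex \<Rightarrow> 'a::ab_group_add \<Rightarrow> 'a) \<Rightarrow> 'a set \<Rightarrow>
   (complex \<Rightarrow> 'b::ab_group_add \<Rightarrow> 'b) \<Rightarrow> 'b set \<Rightarrow>
   ('a \<Rightarrow> 'b) \<Rightarrow> ('a \<Rightarrow> 'b) \<Rightarrow> kblock list \<Rightarrow> bool" where
  "has_kronecker_form s U t W A B bs \<longleftrightarrow>
     (\<forall>b \<in> set bs. valid_block b) \<and>
     (\<exists>us ws. ordered_basis s U us \<and> ordered_basis t W ws \<and>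
        represented_by t us ws A (diag_block_mat (map block_A bs)) \<and>
        represented_by t us ws B (diag_block_mat (map block_B bs)))"

section \<open>Algebraic type of a pencil\<close>

text \<open>
  \<open>jordan_sizes\<close> has one member for each distinct eigenvalue, namely the multiset of the sizes of
  the Jordan blocks with that eigenvalue.  The values of the eigenvalues are forgotten.
\<close>

record pencil_type =
  jordan_sizes :: "nat multiset multiset"
  horizontal_indices :: "nat multiset"
  vertical_indices :: "nat multiset"

definition block_eigenvalues :: "kblock list \<Rightarrow> pencil_eigenvalue set" where
  "block_eigenvalues bs = {e. \<exists>k. Jordan e k \<in> set bs}"

definition sizes_for_eigenvalue :: "kblock list \<Rightarrow> pencil_eigenvalue \<Rightarrow> nat multiset" where
  "sizes_for_eigenvalue bs e =
     mset (concat (map (\<lambda>b. case b of Jordan e' k \<Rightarrow> if e' = e then [k] else [] | _ \<Rightarrow> []) bs))"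

definition type_of_blocks :: "kblock list \<Rightarrow> pencil_type" where
  "type_of_blocks bs =
     \<lparr> jordan_sizes = image_mset (sizes_for_eigenvalue bs) (mset_set (block_eigenvalues bs)),
       horizontal_indices =
         mset (concat (map (\<lambda>b. case b of Horizontal h \<Rightarrow> [h] | _ \<Rightarrow> []) bs)),
       vertical_indices =
         mset (concat (map (\<lambda>b. case b of Vertical v \<Rightarrow> [v] | _ \<Rightarrow> []) bs)) \<rparr>"

text \<open>By Kronecker's theorem every pencil has exactly one algebraic type.\<close>

definition has_algebraic_type ::
  "(complex \<Rightarrow> 'a::ab_group_add \<Rightarrow> 'a) \<Rightarrow> 'a set \<Rightarrow>
   (complex \<Rightarrow> 'b::ab_group_add \<Rightarrow> 'b) \<Rightarrow> 'b set \<Rightarrow>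
   ('a \<Rightarrow> 'b) \<Rightarrow> ('a \<Rightarrow> 'b) \<Rightarrow> pencil_type \<Rightarrow> bool" where
  "has_algebraic_type s U t W A B \<tau> \<longleftrightarrow>
     (\<exists>bs. has_kronecker_form s U t W A B bs \<and> type_of_blocks bs = \<tau>)"

section \<open>Zariski open sets\<close>

text \<open>
  Complex polynomial functions, i.e. the algebra generated by the \<open>s\<close>-linear functionals.
  (The library's \<^const>\<open>polynomial_function\<close> is real polynomial and would admit conjugation.)
\<close>

inductive_set polynomial_functions ::
  "(complex \<Rightarrow> 'a::ab_group_add \<Rightarrow> 'a) \<Rightarrow> ('a \<Rightarrow> complex) set"
  for s :: "complex \<Rightarrow> 'a::ab_group_add \<Rightarrow> 'a" where
  functional: "Vector_Spaces.linear s (*) f \<Longrightarrow> f \<in> polynomial_functions s"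
| const: "(\<lambda>_. c) \<in> polynomial_functions s"
| add: "\<lbrakk>p \<in> polynomial_functions s; q \<in> polynomial_functions s\<rbrakk>
    \<Longrightarrow> (\<lambda>x. p x + q x) \<in> polynomial_functions s"
| mult: "\<lbrakk>p \<in> polynomial_functions s; q \<in> polynomial_functions s\<rbrakk>
    \<Longrightarrow> (\<lambda>x. p x * q x) \<in> polynomial_functions s"

text \<open>
  The complements in \<open>W\<close> of common zero sets.  Functionals on the subspace \<open>W\<close> extend to the whole
  type, so the polynomial functions on \<open>W\<close> are the restrictions of those above.
\<close>

definition zariski_open_in ::
  "(complex \<Rightarrow> 'a::ab_group_add \<Rightarrow> 'a) \<Rightarrow> 'a set \<Rightarrow> 'a set \<Rightarrow> bool" where
  "zariski_open_in s W S \<longleftrightarrow>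
     (\<exists>F \<subseteq> polynomial_functions s. S = {x \<in> W. \<exists>p \<in> F. p x \<noteq> 0})"

section \<open>Jordan--Kronecker invariants of a representation\<close>

text \<open>
  \<open>\<rho> \<xi> x\<close> is the action of \<open>\<xi> \<in> \<gg>\<close> on \<open>x \<in> W\<close>.  The Lie bracket plays no role in the definition.
\<close>

definition orbit_map :: "('g \<Rightarrow> 'w \<Rightarrow> 'w) \<Rightarrow> 'w \<Rightarrow> 'g \<Rightarrow> 'w" where
  "orbit_map \<rho> x = (\<lambda>\<xi>. \<rho> \<xi> x)"

definition has_JK_invariants ::
  "(complex \<Rightarrow> 'g::ab_group_add \<Rightarrow> 'g) \<Rightarrow> 'g set \<Rightarrow>
   (complex \<Rightarrow> 'w::ab_group_add \<Rightarrow> 'w) \<Rightarrow> 'w set \<Rightarrow>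
   ('g \<Rightarrow> 'w \<Rightarrow> 'w) \<Rightarrow> pencil_type \<Rightarrow> bool" where
  "has_JK_invariants s \<gg> t W \<rho> \<tau> \<longleftrightarrow>
     (\<exists>S. zariski_open_in (module_prod.scale t t) (W \<times> W) S \<and> S \<noteq> {} \<and>
        (\<forall>(a, b) \<in> S. has_algebraic_type s \<gg> t W (orbit_map \<rho> a) (orbit_map \<rho> b) \<tau>))"

section \<open>The congruence action on symmetric forms\<close>

text \<open>\<open>V\<close> is \<open>\<complex>\<^sup>n\<close> with \<open>n = CARD('n)\<close>, and \<open>gl(V)\<close> is all of \<^typ>\<open>complex^'n^'n\<close>.\<close>

definition mat_scale :: "complex \<Rightarrow> complex^'n^'n \<Rightarrow> complex^'n^'n" where
  "mat_scale c X = (\<chi> i j. c * X $ i $ j)"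

definition symmetric_forms :: "(complex^'n^'n) set" where
  "symmetric_forms = {Q. Finite_Cartesian_Product.transpose Q = Q}"

definition congruence_rep :: "complex^'n^'n \<Rightarrow> complex^'n^'n \<Rightarrow> complex^'n^'n" where
  "congruence_rep X Q = X ** Q + Q ** Finite_Cartesian_Product.transpose X"

lemma vector_space_mat_scale: "vector_space mat_scale"
  by unfold_locales (auto simp: mat_scale_def Finite_Cartesian_Product.vec_eq_iff algebra_simps)

lemma subspace_symmetric_forms: "module.subspace mat_scale symmetric_forms"
proof -
  interpret vector_space mat_scale by (rule vector_space_mat_scale)
  show ?thesis
    by (auto simp: subspace_def symmetric_forms_def mat_scale_def Finite_Cartesian_Product.vec_eq_iff
        Finite_Cartesian_Product.transpose_def)
qed

lemma congruence_rep_symmetric: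
  "Q \<in> symmetric_forms \<Longrightarrow> congruence_rep X Q \<in> symmetric_forms"
  by (auto simp: symmetric_forms_def congruence_rep_def Finite_Cartesian_Product.vec_eq_iff matrix_matrix_mult_def
      Finite_Cartesian_Product.transpose_def mult.commute add.commute)

lemma congruence_rep_bracket:
  fixes X Y Q :: "complex^'n^'n"
  shows "congruence_rep (X ** Y - Y ** X) Q =
     congruence_rep X (congruence_rep Y Q) - congruence_rep Y (congruence_rep X Q)"
proof -
  have distribs: "(A - B) ** C = A ** C - B ** C" "C ** (A - B) = C ** A - C ** B"
    "(A + B) ** C = A ** C + B ** C" "C ** (A + B) = C ** A + C ** B"
    for A B C :: "complex^'n^'n"
    by (simp_all add: Finite_Cartesian_Product.vec_eq_iff matrix_matrix_mult_def algebra_simps sum_subtractf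
        sum.distrib)
  have tr: "Finite_Cartesian_Product.transpose (A - B) =
      Finite_Cartesian_Product.transpose A - Finite_Cartesian_Product.transpose B"
    for A B :: "complex^'n^'n"
    by (simp add: Finite_Cartesian_Product.vec_eq_iff Finite_Cartesian_Product.transpose_def)
  show ?thesis
    by (simp add: congruence_rep_def distribs tr matrix_transpose_mul matrix_mul_assoc)
qed

end

(*
  Where the discriminant of det(x b - a) and det b do not vanish, the generalized eigenvectors of
  the symmetric pair (a, b) are orthogonal for b.  Hence a = Q D Q^T and b = Q Q^T for an invertible
  Q and a diagonal D = diag(l) with distinct entries.  Since
    R_(Q c Q^T)(Q X Q^-1) = Q R_c(X) Q^T,
  the pencil is equivalent to the one of (D, 1).  There E_ij is sent to l_j S_ij by R_D and to S_ij
  by R_1, where S_ij = E_ij + E_ji.  So E_ii spans a 1x1 Jordan block with eigenvalue l_i, and each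
  pair i < j yields a 1x2 horizontal block on the span of E_ij and E_ji.
*)
theory Submission
  imports Defs
begin

text \<open>The obstacle is genericity: the open set must be cut out by functions that are
  polynomial in the entries of \<open>a\<close> and \<open>b\<close>, whereas the type of the pencil
  is governed by the eigenvalues of the inverse of \<open>b\<close> times \<open>a\<close>.
  Replacing the inverse by the adjugate only scales the eigenvalues by \<open>det b\<close>, which
  keeps them distinct where \<open>det b\<close> is nonzero. Two facts about the resulting
  polynomial then suffice: off its zero set there are n distinct eigenvalues, and it is nonzero at
  some symmetric pair.

  The block structure is forced by the plane of E_ij and E_ji: both orbit maps send it to the single
  line of S_ij, so there the pencil is a pair of linear forms on a plane, and these are independent
  exactly because l_i and l_j differ. Each such block has one column more than rows, in accordance
  with n^2 - n(n+1)/2 = n(n-1)/2.\<close>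

section \<open>Bases from dual functionals, and block-diagonal matrices\<close>

text \<open>Applying \<open>f k\<close> to a combination of the \<open>u l\<close> reads off its
  k-th coefficient, which gives independence. A vector of \<open>U\<close> differs from its
  coordinate expansion by something that all functionals kill, which gives spanning. Explicit
  coordinates thus replace any dimension count.\<close>

lemma ordered_basis_dualI:
  assumes "vector_space s" and U: "module.subspace s U" and ks: "distinct ks"
    and u: "\<And>k. k \<in> set ks \<Longrightarrow> u k \<in> U"
    and f: "\<And>k. k \<in> set ks \<Longrightarrow> Vector_Spaces.linear s (*) (f k)"
    and dual: "\<And>k l. k \<in> set ks \<Longrightarrow> l \<in> set ks \<Longrightarrow> f k (u l) = (if k = l then 1 else 0)"
    and sep: "\<And>x. x \<in> U \<Longrightarrow> (\<And>k. k \<in> set ks \<Longrightarrow> f k x = 0) \<Longrightarrow> x = 0"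
  shows "ordered_basis s U (map u ks)"
proof -
  interpret vector_space s by fact
  have add: "f k (x + y) = f k x + f k y" and scale: "f k (s c x) = c * f k x"
    if "k \<in> set ks" for k c x y
    using f[OF that] by (auto simp: Vector_Spaces.linear_iff)
  have zero: "f k 0 = 0" if "k \<in> set ks" for k
    using add[OF that, of 0 0] by simp
  have comb: "f k (\<Sum>l\<in>A. s (c l) (u l)) = (if k \<in> A then c k else 0)"
    if "k \<in> set ks" "A \<subseteq> set ks" for k c A
  proof -
    have "finite A"
      using that(2) finite_subset by blast
    then have "f k (\<Sum>l\<in>A. s (c l) (u l)) = (\<Sum>l\<in>A. c l * f k (u l))"
      by (induction A rule: finite_induct) (simp_all add: zero add scale that(1))
    also have "\<dots> = (\<Sum>l\<in>A. if k = l then c l else 0)"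
      using that by (intro sum.cong) (auto simp: dual)
    finally show ?thesis
      using \<open>finite A\<close> by simp
  qed
  have inj: "inj_on u (set ks)"
    by (intro inj_onI) (metis dual zero_neq_one)
  have "independent (u ` set ks)"
  proof (rule independent_if_scalars_zero)
    fix c x assume 0: "(\<Sum>x\<in>u ` set ks. s (c x) x) = 0" and "x \<in> u ` set ks"
    then obtain k where k: "k \<in> set ks" "x = u k"
      by auto
    have "(\<Sum>l\<in>set ks. s (c (u l)) (u l)) = 0"
      using 0 by (simp add: sum.reindex[OF inj])
    then show "c x = 0"
      using comb[OF k(1) order.refl, of "\<lambda>l. c (u l)"] k zero[OF k(1)] by simp
  qed simp
  moreover have "span (u ` set ks) = U"
  proof
    show "span (u ` set ks) \<subseteq> U"
      using u U by (intro span_minimal) auto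
    show "U \<subseteq> span (u ` set ks)"
    proof
      fix x assume x: "x \<in> U"
      define y where "y = (\<Sum>l\<in>set ks. s (f l x) (u l))"
      have yU: "y \<in> U"
        unfolding y_def using u U by (intro subspace_sum subspace_scale) auto
      have "f k (x - y) = 0" if k: "k \<in> set ks" for k
        using add[OF k, of "x - y" y] comb[OF k order.refl, of "\<lambda>l. f l x"] k
        by (simp add: y_def)
      then have "x = y"
        using sep[of "x - y"] subspace_diff[OF U x yU] by simp
      moreover have "y \<in> span (u ` set ks)"
        unfolding y_def by (intro span_sum span_scale span_base imageI)
      ultimately show "x \<in> span (u ` set ks)"
        by simp
    qed
  qed
  ultimately show ?thesis
    using ks inj by (simp add: ordered_basis_def distinct_map)
qed

lemma sum_lessThan_add:
  fixes g :: "nat \<Rightarrow> 'a::comm_monoid_add"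
  shows "(\<Sum>i<m + n. g i) = (\<Sum>i<m. g i) + (\<Sum>i<n. g (m + i))"
  by (induction n) (simp_all add: add.assoc)

lemma represented_by_append:
  assumes t: "vector_space t"
    and M: "represented_by t us ws f M" and N: "represented_by t us' ws' f N"
  shows "represented_by t (us @ us') (ws @ ws') f
           (four_block_mat M (0\<^sub>m (length ws) (length us')) (0\<^sub>m (length ws') (length us)) N)"
    (is "represented_by _ _ _ _ ?F")
proof -
  interpret vector_space t by fact
  have MN: "M \<in> carrier_mat (length ws) (length us)" "N \<in> carrier_mat (length ws') (length us')"
    and Mf: "\<And>j. j < length us \<Longrightarrow> f (us ! j) = (\<Sum>i<length ws. t (M $$ (i, j)) (ws ! i))"
    and Nf: "\<And>j. j < length us' \<Longrightarrow> f (us' ! j) = (\<Sum>i<length ws'. t (N $$ (i, j)) (ws' ! i))"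
    using M N by (auto simp: represented_by_def)
  have "f ((us @ us') ! j) = (\<Sum>i<length (ws @ ws'). t (?F $$ (i, j)) ((ws @ ws') ! i))"
    if j: "j < length (us @ us')" for j
  proof (cases "j < length us")
    case True
    then show ?thesis
      using MN j by (simp add: nth_append sum_lessThan_add Mf)
  next
    case False
    then have "j - length us < length us'"
      using j by simp
    then show ?thesis
      using MN j False by (simp add: nth_append sum_lessThan_add Nf)
  qed
  with MN show ?thesis
    by (auto simp: represented_by_def)
qed

text \<open>Reduces the large matrix to a check per block: \<open>f\<close> sends the k-th segment
  of the domain list into the span of the k-th segment of the codomain list.\<close>

lemma represented_by_diag_block_mat:
  assumes t: "vector_space t"
    and "\<And>k. k \<in> set ks \<Longrightarrow> represented_by t (us k) (ws k) f (M k)"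
  shows "represented_by t (concat (map us ks)) (concat (map ws ks)) f (diag_block_mat (map M ks))"
  using assms(2)
proof (induction ks)
  case Nil
  then show ?case
    by (simp add: represented_by_def)
next
  case (Cons k ks)
  have 1: "represented_by t (us k) (ws k) f (M k)"
    and 2: "represented_by t (concat (map us ks)) (concat (map ws ks)) f (diag_block_mat (map M ks))"
    using Cons by simp_all
  then have "M k \<in> carrier_mat (length (ws k)) (length (us k))"
    "diag_block_mat (map M ks)
      \<in> carrier_mat (length (concat (map ws ks))) (length (concat (map us ks)))"
    by (simp_all add: represented_by_def)
  then show ?case
    using represented_by_append[OF t 1 2] by (simp add: Let_def)
qed

section \<open>Transport of the Kronecker form to an equivalent pencil\<close>

lemma ordered_basis_image:
  assumes \<phi>: "Vector_Spaces.linear s s' \<phi>" and inj: "inj \<phi>" and us: "ordered_basis s U us"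
  shows "ordered_basis s' (\<phi> ` U) (map \<phi> us)"
proof -
  interpret Vector_Spaces.linear s s' \<phi> by fact
  show ?thesis
    using us dependent_inj_imageD[of "set us"] inj_on_subset[OF inj subset_UNIV]
    by (auto simp: ordered_basis_def distinct_map span_image)
qed

lemma represented_by_image:
  assumes "Vector_Spaces.linear t t' \<psi>" and "\<And>x. A' (\<phi> x) = \<psi> (A x)"
    and "represented_by t us ws A M"
  shows "represented_by t' (map \<phi> us) (map \<psi> ws) A' M"
proof -
  interpret Vector_Spaces.linear t t' \<psi> by fact
  show ?thesis
    using assms(2,3) by (auto simp: represented_by_def sum scale)
qed

text \<open>Transported bases yield literally the same matrices. The target spaces are taken as
  images, so injectivity of the two maps is enough.\<close>

lemma has_kronecker_form_image:
  assumes "Vector_Spaces.linear s s' \<phi>" "inj \<phi>" and "Vector_Spaces.linear t t' \<psi>" "inj \<psi>"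
    and "\<And>x. A' (\<phi> x) = \<psi> (A x)" "\<And>x. B' (\<phi> x) = \<psi> (B x)"
    and "has_kronecker_form s U t W A B bs"
  shows "has_kronecker_form s' (\<phi> ` U) t' (\<psi> ` W) A' B' bs"
proof -
  obtain us ws where "ordered_basis s U us" "ordered_basis t W ws"
    "represented_by t us ws A (diag_block_mat (map block_A bs))"
    "represented_by t us ws B (diag_block_mat (map block_B bs))"
    and valid: "\<forall>b\<in>set bs. valid_block b"
    using assms(7) unfolding has_kronecker_form_def by auto
  then have "ordered_basis s' (\<phi> ` U) (map \<phi> us)" "ordered_basis t' (\<psi> ` W) (map \<psi> ws)"
    "represented_by t' (map \<phi> us) (map \<psi> ws) A' (diag_block_mat (map block_A bs))"
    "represented_by t' (map \<phi> us) (map \<psi> ws) B' (diag_block_mat (map block_B bs))"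
    using assms(1-6) by (auto intro: ordered_basis_image represented_by_image)
  with valid show ?thesis
    unfolding has_kronecker_form_def by blast
qed

section \<open>The pencil at a diagonal matrix and the identity\<close>

definition diagonal_matrix :: "('n \<Rightarrow> complex) \<Rightarrow> complex^'n^'n" where
  "diagonal_matrix d = (\<chi> i j. if i = j then d i else 0)"

lemma diagonal_matrix_nth [simp]: "diagonal_matrix d $ i $ j = (if i = j then d i else 0)"
  by (simp add: diagonal_matrix_def)

lemma congruence_rep_diagonal_nth:
  "congruence_rep X (diagonal_matrix d) $ i $ j = X $ i $ j * d j + d i * X $ j $ i"
  by (simp add: congruence_rep_def matrix_matrix_mult_def Finite_Cartesian_Product.transpose_def
      if_distrib[of "\<lambda>x. x * _"] if_distrib[of "\<lambda>x. _ * x"] cong: if_cong)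

text \<open>This is x E_ij + y E_ji for distinct indices. On the diagonal the first test wins, so
  the result is x E_ii and not (x + y) E_ii.\<close>

definition pair_matrix :: "'n \<Rightarrow> 'n \<Rightarrow> complex \<Rightarrow> complex \<Rightarrow> complex^'n^'n" where
  "pair_matrix i j x y =
     (\<chi> a b. if a = i \<and> b = j then x else if a = j \<and> b = i then y else 0)"

lemma pair_matrix_nth [simp]:
  "pair_matrix i j x y $ a $ b =
     (if a = i \<and> b = j then x else if a = j \<and> b = i then y else 0)"
  by (simp add: pair_matrix_def)

text \<open>The value 2 makes this E_ij + E_ji for equal indices too, so that the identity acts on
  E_ii with coefficient 1.\<close>

definition symmetric_unit :: "'n \<times> 'n \<Rightarrow> complex^'n^'n" where
  "symmetric_unit = (\<lambda>(i, j). if i = j then pair_matrix i j 2 2 else pair_matrix i j 1 1)"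

text \<open>The coefficient is a linear form in (x, y). For the diagonals \<open>l\<close> and 1 the
  forms are x l_j + y l_i and x + y; a pair of independent forms on a plane is a horizontal block of
  width 2.\<close>

lemma congruence_rep_diagonal_pair:
  "i \<noteq> j \<Longrightarrow> congruence_rep (pair_matrix i j x y) (diagonal_matrix d) =
     mat_scale (x * d j + y * d i) (symmetric_unit (i, j))"
  by (auto simp: Finite_Cartesian_Product.vec_eq_iff congruence_rep_diagonal_nth mat_scale_def
      symmetric_unit_def)

lemma congruence_rep_diagonal_unit:
  "congruence_rep (pair_matrix i i 1 1) (diagonal_matrix d) =
     mat_scale (d i) (symmetric_unit (i, i))"
  by (auto simp: Finite_Cartesian_Product.vec_eq_iff congruence_rep_diagonal_nth mat_scale_def
      symmetric_unit_def)

definition rep_block :: "('n \<Rightarrow> complex) \<Rightarrow> 'n \<times> 'n \<Rightarrow> kblock" where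
  "rep_block l = (\<lambda>(i, j). if i = j then Jordan (Finite (l i)) 1 else Horizontal 2)"

text \<open>The injection \<open>g\<close> orders the index type, so that one of (i, j) and (j, i)
  can be singled out.\<close>

locale distinct_diagonal =
  fixes l :: "'n::finite \<Rightarrow> complex" and g :: "'n \<Rightarrow> nat"
  assumes inj_l: "inj l" and inj_g: "inj g"
begin

text \<open>
  Write \<open>L = R\<^sub>a\<close> for \<open>a = diag l\<close> and \<open>K = R\<^sub>b\<close> for \<open>b = 1\<close>.  For \<open>g i < g j\<close> the
  vectors at \<open>(i, j)\<close> and \<open>(j, i)\<close> solve \<open>K u = S, L u = 0\<close> and \<open>K u = 0, L u = S\<close>, where \<open>S\<close> is the
  symmetric unit at \<open>(i, j)\<close>.  The coordinates dual to them are the \<open>(i, j)\<close> entries of \<open>K X\<close> and of \<open>L X\<close>.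
\<close>

definition domain_vector :: "'n \<times> 'n \<Rightarrow> complex^'n^'n" where
  "domain_vector = (\<lambda>(i, j).
     if i = j then pair_matrix i i 1 1
     else if g i < g j then pair_matrix i j (- l i / (l j - l i)) (l j / (l j - l i))
     else pair_matrix j i (1 / (l i - l j)) (- 1 / (l i - l j)))"

definition domain_coord :: "'n \<times> 'n \<Rightarrow> complex^'n^'n \<Rightarrow> complex" where
  "domain_coord = (\<lambda>(i, j) X.
     if i = j then X $ i $ i
     else if g i < g j then X $ i $ j + X $ j $ i
     else l i * X $ j $ i + l j * X $ i $ j)"

lemma g_eq [simp]: "g i = g j \<longleftrightarrow> i = j"
  using inj_g by (auto dest: injD)

lemma l_eq [simp]: "l i = l j \<longleftrightarrow> i = j"
  using inj_l by (auto dest: injD)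

lemma linear_domain_coord: "Vector_Spaces.linear mat_scale (*) (domain_coord k)"
  by (cases k) (auto simp: Vector_Spaces.linear_iff vector_space_mat_scale
      vector_space_over_itself.vector_space_axioms domain_coord_def mat_scale_def algebra_simps)

lemma domain_coord_vector: "domain_coord k (domain_vector k') = (if k = k' then 1 else 0)"
proof (cases k; cases k')
  fix i j i' j' assume k: "k = (i, j)" "k' = (i', j')"
  consider "i' = j'" | "g i' < g j'" | "g j' < g i'"
    by (metis g_eq linorder_neqE_nat)
  then show ?thesis
  proof cases
    case 1
    then show ?thesis by (auto simp: k domain_coord_def domain_vector_def)
  next
    case 2
    then have "l j' - l i' \<noteq> 0" by auto
    \<comment> \<open>This is the nonvanishing of the square of \<open>l j' - l i'\<close>,
      multiplied out.\<close>
    moreover from this have "l i' * l i' + l j' * l j' \<noteq> l i' * (l j' * 2)"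
      using mult_eq_0_iff[of "l j' - l i'" "l j' - l i'"] by (auto simp: algebra_simps)
    ultimately show ?thesis using 2 by (auto simp: k domain_coord_def domain_vector_def field_simps)
  next
    case 3
    then have "l j' - l i' \<noteq> 0" "l i' - l j' \<noteq> 0" by auto
    with 3 show ?thesis by (auto simp: k domain_coord_def domain_vector_def divide_simps)
  qed
qed

text \<open>For each off-diagonal pair the two coordinates form a linear system in X_ij and X_ji
  with determinant l_i - l_j.\<close>

lemma domain_coord_separates:
  assumes "\<And>k. domain_coord k X = 0"
  shows "X = 0"
proof -
  have *: "X $ i $ j = 0 \<and> X $ j $ i = 0" if "g i < g j" for i j
  proof -
    have 1: "X $ i $ j + X $ j $ i = 0" and 2: "l j * X $ i $ j + l i * X $ j $ i = 0"
      using assms[of "(i, j)"] assms[of "(j, i)"] that by (auto simp: domain_coord_def split: if_splits)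
    have "X $ j $ i = - X $ i $ j"
      using 1 by (simp add: add_eq_0_iff2)
    with 2 have "(l j - l i) * X $ i $ j = 0"
      by (simp add: algebra_simps)
    with that \<open>X $ j $ i = - X $ i $ j\<close> show ?thesis
      by auto
  qed
  have "X $ i $ j = 0" for i j
    using *[of i j] *[of j i] assms[of "(i, i)"]
    by (cases "g i" "g j" rule: linorder_cases) (auto simp: domain_coord_def)
  then show ?thesis
    by (simp add: Finite_Cartesian_Product.vec_eq_iff)
qed

lemma basis_domain:
  assumes "distinct ks" "set ks = UNIV"
  shows "ordered_basis mat_scale UNIV (map domain_vector ks)"
proof -
  interpret vector_space "mat_scale :: complex \<Rightarrow> complex^'n^'n \<Rightarrow> complex^'n^'n"
    by (rule vector_space_mat_scale)
  show ?thesis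
    by (rule ordered_basis_dualI[where f = domain_coord, OF vector_space_mat_scale subspace_UNIV assms(1)])
      (auto simp: assms(2) linear_domain_coord domain_coord_vector domain_coord_separates)
qed

lemma basis_codomain:
  assumes "distinct ks" "set ks = {(i, j). g i \<le> g j}"
  shows "ordered_basis mat_scale symmetric_forms (map symmetric_unit ks)"
proof (rule ordered_basis_dualI[OF vector_space_mat_scale subspace_symmetric_forms assms(1)])
  \<comment> \<open>The division by 2 compensates the diagonal entry 2 of
    \<open>symmetric_unit (i, i)\<close>.\<close>
  let ?f = "\<lambda>(i, j) X. if i = j then X $ i $ i / 2 else X $ i $ j"
  show "symmetric_unit k \<in> symmetric_forms" for k :: "'n \<times> 'n"
    by (cases k) (auto simp: symmetric_forms_def Finite_Cartesian_Product.transpose_def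
        Finite_Cartesian_Product.vec_eq_iff symmetric_unit_def)
  show "Vector_Spaces.linear mat_scale (*) (?f k)" for k :: "'n \<times> 'n"
    by (cases k) (auto simp: Vector_Spaces.linear_iff vector_space_mat_scale
        vector_space_over_itself.vector_space_axioms mat_scale_def add_divide_distrib)
  show "?f k (symmetric_unit k') = (if k = k' then 1 else 0)" if "k \<in> set ks" "k' \<in> set ks" for k k'
    using that by (auto simp: assms(2) symmetric_unit_def split: if_splits)
  fix X assume X: "X \<in> symmetric_forms" and 0: "\<And>k. k \<in> set ks \<Longrightarrow> ?f k X = 0"
  have "X $ i $ j = X $ j $ i" for i j
    using X by (metis (mono_tags, lifting) mem_Collect_eq symmetric_forms_def
        Finite_Cartesian_Product.transpose_def vec_lambda_beta)
  moreover have "X $ i $ j = 0" if "g i \<le> g j" for i j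
    using 0[of "(i, j)"] that by (auto simp: assms(2) split: if_splits)
  ultimately show "X = 0"
    by (metis (no_types) Finite_Cartesian_Product.vec_eq_iff nle_le zero_index)
qed

text \<open>The order \<open>[k, prod.swap k]\<close> matters: the first vector is killed by the map
  of \<open>l\<close> and the second by the map of 1, which matches (0 | 1) for
  \<open>block_A\<close> and (1 | 0) for \<open>block_B\<close>.\<close>

lemma represented_by_block:
  fixes k :: "'n \<times> 'n"
  assumes "g (fst k) \<le> g (snd k)"
  defines "us \<equiv> map domain_vector (if fst k = snd k then [k] else [k, prod.swap k])"
  shows "represented_by mat_scale us [symmetric_unit k] (orbit_map congruence_rep (diagonal_matrix l))
           (block_A (rep_block l k))" (is ?A)
    and "represented_by mat_scale us [symmetric_unit k] (orbit_map congruence_rep (diagonal_matrix (\<lambda>_. 1)))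
           (block_B (rep_block l k))" (is ?B)
proof -
  obtain i j where k: "k = (i, j)" by (cases k)
  consider "i = j" | "g i < g j"
    using assms k by fastforce
  then have "?A \<and> ?B"
  proof cases
    case 1
    then show ?thesis
      by (simp add: k us_def represented_by_def rep_block_def orbit_map_def domain_vector_def
          congruence_rep_diagonal_unit jordan_block_def)
  next
    case 2
    then have ij: "i \<noteq> j" "l j - l i \<noteq> 0" by auto
    \<comment> \<open>The coefficients x d_j + y d_i of the two vectors, first for d =
      \<open>l\<close> and then for d = 1; they are the entries of the two 1x2 matrices.\<close>
    have A: "- l i / (l j - l i) * l j + l j / (l j - l i) * l i = 0"
      "1 / (l j - l i) * l j + - 1 / (l j - l i) * l i = 1"
      "- l i / (l j - l i) * 1 + l j / (l j - l i) * 1 = 1"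
      "1 / (l j - l i) * 1 + - 1 / (l j - l i) * 1 = 0"
      using ij(2) by (auto simp: divide_simps)
    have "domain_vector (i, j) = pair_matrix i j (- l i / (l j - l i)) (l j / (l j - l i))"
      "domain_vector (j, i) = pair_matrix i j (1 / (l j - l i)) (- 1 / (l j - l i))"
      using 2 ij by (auto simp: domain_vector_def)
    then have
      "congruence_rep (domain_vector (i, j)) (diagonal_matrix l) = mat_scale 0 (symmetric_unit (i, j))"
      "congruence_rep (domain_vector (j, i)) (diagonal_matrix l) = mat_scale 1 (symmetric_unit (i, j))"
      "congruence_rep (domain_vector (i, j)) (diagonal_matrix (\<lambda>_. 1)) = mat_scale 1 (symmetric_unit (i, j))"
      "congruence_rep (domain_vector (j, i)) (diagonal_matrix (\<lambda>_. 1)) = mat_scale 0 (symmetric_unit (i, j))"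
      by (simp_all only: congruence_rep_diagonal_pair[OF ij(1)] A)
    then show ?thesis
      using ij(1) by (simp add: k us_def represented_by_def rep_block_def orbit_map_def
          zero_one_block_def one_zero_block_def less_2_cases_iff all_conj_distrib
          forall_2 numeral_2_eq_2 less_Suc_eq)
  qed
  then show ?A ?B by auto
qed

end

section \<open>Counting the blocks\<close>

text \<open>Injectivity of \<open>l\<close> enters twice: it makes the number of eigenvalues n, and
  it leaves each eigenvalue a single block.\<close>

lemma type_of_rep_blocks:
  fixes l :: "'n::finite \<Rightarrow> complex"
  assumes "inj l" and ms_distinct: "distinct ms" "set ms = UNIV" and ps: "\<And>p. p \<in> set ps \<Longrightarrow> fst p \<noteq> snd p"
  shows "type_of_blocks (map (rep_block l) (map (\<lambda>i. (i, i)) ms @ ps)) =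
     \<lparr> jordan_sizes = replicate_mset CARD('n) {#1#},
       horizontal_indices = replicate_mset (length ps) 2,
       vertical_indices = {#} \<rparr>" (is "type_of_blocks ?bs = _")
proof -
  have bs: "?bs = map (\<lambda>i. Jordan (Finite (l i)) 1) ms @ map (\<lambda>_. Horizontal 2) ps"
    using ps by (auto simp: rep_block_def)
  have eigen: "block_eigenvalues ?bs = Finite ` range l"
    unfolding bs block_eigenvalues_def using ms_distinct by auto
  have card: "card (Finite ` range l) = CARD('n)"
    using \<open>inj l\<close> by (simp add: card_image inj_on_def)
  have sizes: "sizes_for_eigenvalue ?bs (Finite (l i)) = {#1#}" for i
  proof -
    have "sizes_for_eigenvalue ?bs (Finite (l i)) =
        mset (concat (map (\<lambda>j. if l j = l i then [1] else []) ms))"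
      unfolding bs sizes_for_eigenvalue_def by (simp add: comp_def cong: if_cong)
    also have "\<dots> = (\<Sum>j\<leftarrow>ms. if l j = l i then {#1#} else {#})"
      by (simp add: mset_concat comp_def if_distrib cong: if_cong)
    also have "\<dots> = (\<Sum>j\<in>UNIV. if l j = l i then {#1#} else {#})"
      using ms_distinct by (simp add: sum_list_distinct_conv_sum_set)
    also have "\<dots> = {#1#}"
      using \<open>inj l\<close> by (simp add: inj_eq)
    finally show ?thesis .
  qed
  have "image_mset (sizes_for_eigenvalue ?bs) (mset_set (block_eigenvalues ?bs)) =
      image_mset (\<lambda>_. {#1#}) (mset_set (block_eigenvalues ?bs))"
  proof (rule image_mset_cong)
    fix e assume "e \<in># mset_set (block_eigenvalues ?bs)"
    then have "e \<in> Finite ` range l"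
      unfolding eigen by simp
    then show "sizes_for_eigenvalue ?bs e = {#1#}"
      using sizes by blast
  qed
  also have "\<dots> = replicate_mset CARD('n) {#1#}"
    by (simp only: image_mset_const_eq size_mset_set eigen card)
  finally have "jordan_sizes (type_of_blocks ?bs) = replicate_mset CARD('n) {#1#}"
    by (simp add: type_of_blocks_def)
  moreover have "horizontal_indices (type_of_blocks ?bs) = replicate_mset (length ps) 2"
    unfolding type_of_blocks_def bs
    by (simp add: comp_def) (induction ps; simp)
  moreover have "vertical_indices (type_of_blocks ?bs) = {#}"
    unfolding type_of_blocks_def bs by (simp add: comp_def)
  ultimately show ?thesis
    by simp
qed

text \<open>The square of the index type splits into the diagonal, these pairs and their mirror
  images.\<close>

lemma card_ordered_pairs:
  fixes g :: "'n::finite \<Rightarrow> nat"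
  assumes "inj g"
  shows "card {(i, j). g i < g j} = CARD('n) * (CARD('n) - 1) div 2"
proof -
  let ?P = "{(i, j). g i < g j}"
  have "(i, j) \<in> Id \<union> (?P \<union> prod.swap ` ?P)" for i j
    using assms by (cases "g i" "g j" rule: linorder_cases) (auto simp: image_iff dest: injD)
  then have "UNIV = Id \<union> (?P \<union> prod.swap ` ?P)"
    by (intro UNIV_eq_I) (simp only: split_paired_all)
  then have "card (UNIV :: ('n \<times> 'n) set) = card (Id \<union> (?P \<union> prod.swap ` ?P))"
    by (rule arg_cong)
  also have "\<dots> = card (Id :: ('n \<times> 'n) set) + card (?P \<union> prod.swap ` ?P)"
    by (intro card_Un_disjoint) auto
  also have "card (?P \<union> prod.swap ` ?P) = card ?P + card (prod.swap ` ?P)"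
    by (intro card_Un_disjoint) auto
  also have "card (prod.swap ` ?P) = card ?P"
    by (simp add: card_image)
  also have "card (Id :: ('n \<times> 'n) set) = CARD('n)"
    using card_image[of "\<lambda>i. (i, i)" "UNIV :: 'n set"] by (simp add: inj_on_def image_def Id_def)
  finally have "CARD('n) * CARD('n) = CARD('n) + 2 * card ?P"
    by (simp add: card_prod)
  then have "CARD('n) * (CARD('n) - 1) = 2 * card ?P"
    by (simp add: diff_mult_distrib2)
  then show ?thesis
    by simp
qed

text \<open>One list \<open>ks\<close> drives both bases. It indexes the codomain directly, while
  each of its entries contributes one or two domain vectors, so the segments of the two bases stay
  aligned.\<close>

lemma has_algebraic_type_diagonal:
  fixes l :: "'n::finite \<Rightarrow> complex"
  assumes "inj l"
  shows "has_algebraic_type mat_scale UNIV mat_scale symmetric_forms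
           (orbit_map congruence_rep (diagonal_matrix l))
           (orbit_map congruence_rep (diagonal_matrix (\<lambda>_. 1)))
           \<lparr> jordan_sizes = replicate_mset CARD('n) {#1#},
             horizontal_indices = replicate_mset (CARD('n) * (CARD('n) - 1) div 2) 2,
             vertical_indices = {#} \<rparr>"
proof -
  obtain g :: "'n \<Rightarrow> nat" where g: "inj g"
    using finite_imp_inj_to_nat_seg[of "UNIV :: 'n set"] by auto
  obtain ms :: "'n list" where ms_distinct: "distinct ms" "set ms = UNIV"
    using finite_distinct_list[of "UNIV :: 'n set"] by auto
  obtain ps where ps: "distinct ps" "set ps = {(i, j). g i < g j}"
    using finite_distinct_list[of "{(i, j). g i < g j}"] by auto
  interpret distinct_diagonal l g
    using assms g by unfold_locales
  define ks where "ks = map (\<lambda>i. (i, i)) ms @ ps"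
  define idx where "idx k = (if fst k = snd k then [k] else [k, prod.swap k])" for k :: "'n \<times> 'n"
  have set_ks: "set ks = {(i, j). g i \<le> g j}"
    using ms_distinct ps by (auto simp: ks_def nat_less_le)
  have dist_ks: "distinct ks"
    using ms_distinct ps by (auto simp: ks_def distinct_map inj_on_def)
  have "set (concat (map idx ks)) = UNIV"
  proof -
    have "(i, j) \<in> set (concat (map idx ks))" for i j
    proof (cases "g i \<le> g j")
      case True
      then have "(i, j) \<in> set ks" "(i, j) \<in> set (idx (i, j))"
        by (auto simp: set_ks idx_def)
      then show ?thesis by auto
    next
      case False
      then have "(j, i) \<in> set ks" "(i, j) \<in> set (idx (j, i))"
        by (auto simp: set_ks idx_def)
      then show ?thesis by auto
    qed
    then show ?thesis by auto
  qed
  moreover have "distinct (concat (map idx ks))"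
  proof -
    have dist: "distinct (idx k)" for k
      by (cases k) (auto simp: idx_def)
    \<comment> \<open>The swap of a pair with \<open>g i < g j\<close> is not in \<open>ks\<close>,
      so no domain index is listed under two different entries.\<close>
    moreover have disj: "set (idx k) \<inter> set (idx k') = {}"
      if "k \<in> set ks" "k' \<in> set ks" "k \<noteq> k'" for k k'
      using that unfolding set_ks by (cases k; cases k') (auto simp: idx_def split: if_splits)
    ultimately have "distinct (concat (map idx xs))" if "distinct xs" "set xs \<subseteq> set ks" for xs
      using that
    proof (induction xs)
      case (Cons k xs)
      have "set (idx k) \<inter> set (idx k') = {}" if "k' \<in> set xs" for k'
        using Cons.prems that by (intro disj) auto
      then have "set (idx k) \<inter> set (concat (map idx xs)) = {}"
        unfolding set_concat set_map by blast
      with Cons dist show ?case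
        by simp
    qed simp
    with dist_ks show ?thesis
      by blast
  qed
  ultimately have "ordered_basis mat_scale UNIV (map domain_vector (concat (map idx ks)))"
    by (intro basis_domain)
  then have "ordered_basis mat_scale UNIV (concat (map (\<lambda>k. map domain_vector (idx k)) ks))"
    by (simp add: map_concat comp_def)
  moreover have "ordered_basis mat_scale symmetric_forms (concat (map (\<lambda>k. [symmetric_unit k]) ks))"
    using basis_codomain[OF dist_ks set_ks] by simp
  moreover have
    "represented_by mat_scale (concat (map (\<lambda>k. map domain_vector (idx k)) ks))
       (concat (map (\<lambda>k. [symmetric_unit k]) ks))
       (orbit_map congruence_rep (diagonal_matrix l)) (diag_block_mat (map (\<lambda>k. block_A (rep_block l k)) ks))"
    "represented_by mat_scale (concat (map (\<lambda>k. map domain_vector (idx k)) ks))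
       (concat (map (\<lambda>k. [symmetric_unit k]) ks))
       (orbit_map congruence_rep (diagonal_matrix (\<lambda>_. 1))) (diag_block_mat (map (\<lambda>k. block_B (rep_block l k)) ks))"
    unfolding idx_def using set_ks represented_by_block
    by (intro represented_by_diag_block_mat[OF vector_space_mat_scale]; force)+
  moreover have "\<forall>b\<in>set (map (rep_block l) ks). valid_block b"
    by (auto simp: rep_block_def)
  ultimately have "has_kronecker_form mat_scale UNIV mat_scale symmetric_forms
      (orbit_map congruence_rep (diagonal_matrix l)) (orbit_map congruence_rep (diagonal_matrix (\<lambda>_. 1)))
      (map (rep_block l) ks)"
    unfolding has_kronecker_form_def map_map comp_def by blast
  moreover have "type_of_blocks (map (rep_block l) ks) =
      \<lparr> jordan_sizes = replicate_mset CARD('n) {#1#},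
        horizontal_indices = replicate_mset (CARD('n) * (CARD('n) - 1) div 2) 2,
        vertical_indices = {#} \<rparr>"
  proof -
    have "length ps = CARD('n) * (CARD('n) - 1) div 2"
      using ps card_ordered_pairs[OF g] by (metis distinct_card)
    moreover have "fst p \<noteq> snd p" if "p \<in> set ps" for p
      using that ps by auto
    ultimately show ?thesis
      unfolding ks_def using type_of_rep_blocks[OF assms ms_distinct, of ps] by simp
  qed
  ultimately show ?thesis
    unfolding has_algebraic_type_def by blast
qed

section \<open>Polynomial dependence of determinants and of their coefficients\<close>

lemma polynomial_functions_sum:
  "(\<And>i. i \<in> I \<Longrightarrow> p i \<in> polynomial_functions s) \<Longrightarrow> (\<lambda>x. \<Sum>i\<in>I. p i x) \<in> polynomial_functions s"
  by (induction I rule: infinite_finite_induct)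
    (auto intro: polynomial_functions.intros)

lemma polynomial_functions_prod:
  "(\<And>i. i \<in> I \<Longrightarrow> p i \<in> polynomial_functions s) \<Longrightarrow> (\<lambda>x. \<Prod>i\<in>I. p i x) \<in> polynomial_functions s"
  by (induction I rule: infinite_finite_induct)
    (auto intro: polynomial_functions.intros)

lemma polynomial_functions_if:
  "p \<in> polynomial_functions s \<Longrightarrow> q \<in> polynomial_functions s \<Longrightarrow>
    (\<lambda>x. if c then p x else q x) \<in> polynomial_functions s"
  by (cases c) simp_all

lemma polynomial_functions_det:
  fixes A :: "'a::ab_group_add \<Rightarrow> complex^'n^'n"
  assumes "\<And>i j. (\<lambda>x. A x $ i $ j) \<in> polynomial_functions s"
  shows "(\<lambda>x. Determinants.det (A x)) \<in> polynomial_functions s"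
  unfolding Determinants.det_def
  by (intro polynomial_functions_sum polynomial_functions_prod polynomial_functions.mult
      polynomial_functions.const assms)

text \<open>Here \<open>p x\<close> is itself a polynomial varying with the point \<open>x\<close>.
  Polynomial dependence of every coefficient is the property that survives products, and hence the
  Leibniz formula over \<open>complex poly\<close>.\<close>

lemma polynomial_functions_coeff_mult:
  assumes "\<And>k. (\<lambda>x. coeff (p x) k) \<in> polynomial_functions s"
    and "\<And>k. (\<lambda>x. coeff (q x) k) \<in> polynomial_functions s"
  shows "(\<lambda>x. coeff (p x * q x) k) \<in> polynomial_functions s"
  unfolding coeff_mult using assms
  by (intro polynomial_functions_sum polynomial_functions.mult)

lemma polynomial_functions_coeff_prod:
  assumes "\<And>i k. (\<lambda>x. coeff (p i x) k) \<in> polynomial_functions s"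
  shows "(\<lambda>x. coeff (\<Prod>i\<in>I. p i x) k) \<in> polynomial_functions s"
proof (induction I arbitrary: k rule: infinite_finite_induct)
  case (insert i I)
  then show ?case
    using polynomial_functions_coeff_mult[OF assms] by simp
qed (simp_all add: polynomial_functions.const)

lemma polynomial_functions_coeff_det:
  fixes A :: "'a::ab_group_add \<Rightarrow> complex poly^'n^'n"
  assumes "\<And>i j k. (\<lambda>x. coeff (A x $ i $ j) k) \<in> polynomial_functions s"
  shows "(\<lambda>x. coeff (Determinants.det (A x)) k) \<in> polynomial_functions s"
  unfolding Determinants.det_def coeff_sum
  by (intro polynomial_functions_sum polynomial_functions_coeff_mult polynomial_functions_coeff_prod
      polynomial_functions.const assms)

section \<open>Characteristic polynomial and discriminant of the pencil\<close>

lemma matrix_mult_nth: "(A ** B) $ i $ j = (\<Sum>k\<in>UNIV. A $ i $ k * B $ k $ j)"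
  by (simp add: matrix_matrix_mult_def)

text \<open>This is det (x 1 - N), taken over the polynomial ring so that the Leibniz formula gives
  access to its coefficients.\<close>

definition charpoly :: "complex^'n^'n \<Rightarrow> complex poly" where
  "charpoly N = Determinants.det (\<chi> i j. [:- N $ i $ j, if i = j then 1 else 0:])"

lemma poly_charpoly:
  "poly (charpoly N) x = Determinants.det (\<chi> i j. (if i = j then x else 0) - N $ i $ j)"
  unfolding charpoly_def Determinants.det_def
  by (auto simp: poly_sum poly_prod intro!: sum.cong prod.cong)

text \<open>Each Leibniz term is a product of n factors of degree at most 1. Equality of degrees
  comes later from the coefficient factor in \<open>pencil_discriminant\<close>.\<close>

lemma degree_charpoly_le: "degree (charpoly (N :: complex^'n^'n)) \<le> CARD('n)"
proof -
  have "degree (of_int (sign p) * (\<Prod>i\<in>UNIV. (\<chi> i j. [:- N $ i $ j, if i = j then 1 else 0:]) $ i $ p i))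
      \<le> CARD('n)" for p
  proof -
    have "degree (\<Prod>i\<in>UNIV. (\<chi> i j. [:- N $ i $ j, if i = j then 1 else 0:]) $ i $ p i)
        \<le> (\<Sum>i\<in>(UNIV :: 'n set). 1)"
    proof (rule order.trans[OF degree_prod_sum_le])
      have "degree [:x, y:] \<le> 1" for x y :: complex
        by simp
      then show "sum (degree \<circ> (\<lambda>i. (\<chi> i j. [:- N $ i $ j, if i = j then 1 else 0:]) $ i $ p i)) UNIV
          \<le> (\<Sum>i\<in>(UNIV :: 'n set). 1)"
        unfolding comp_def vec_lambda_beta by (intro sum_mono)
    qed simp
    then show ?thesis
      by (intro order.trans[OF degree_mult_le]) simp
  qed
  then show ?thesis
    unfolding charpoly_def Determinants.det_def by (intro degree_sum_le) auto
qed

lemma charpoly_root_eigenvector: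
  assumes "poly (charpoly N) x = 0"
  obtains v where "v \<noteq> 0" "N *v v = x *s v"
proof -
  let ?A = "(\<chi> i j. (if i = j then x else 0) - N $ i $ j)"
  have "\<not> invertible ?A"
    using assms by (simp add: poly_charpoly invertible_det_nz)
  then obtain v where v: "v \<noteq> 0" "?A *v v = 0"
    using matrix_left_invertible_ker[of ?A] invertible_left_inverse[of ?A] by auto
  have "?A *v v = x *s v - N *v v"
    by (simp add: Finite_Cartesian_Product.vec_eq_iff matrix_vector_mult_def left_diff_distrib
        sum_subtractf if_distrib[of "\<lambda>y. y * _"] cong: if_cong)
  with v that show ?thesis
    by simp
qed

text \<open>Only the coefficients below \<open>m\<close> enter, so that the result is a polynomial in them.\<close>

definition matrix_poly :: "nat \<Rightarrow> complex poly \<Rightarrow> complex^'n^'n \<Rightarrow> complex^'n^'n" where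
  "matrix_poly m p N =
     (\<Sum>k<m. Finite_Cartesian_Product.mat (coeff p k) ** ((**) N ^^ k) (Finite_Cartesian_Product.mat 1))"

lemma mat_mult_vector: "Finite_Cartesian_Product.mat c *v v = c *s (v :: complex^'n)"
  by (simp add: Finite_Cartesian_Product.vec_eq_iff matrix_vector_mult_def Finite_Cartesian_Product.mat_def
        if_distrib[of "\<lambda>y. y * _"] cong: if_cong)

lemma sum_matrix_vector_mult: "(\<Sum>k\<in>I. A k) *v v = (\<Sum>k\<in>I. A k *v (v :: complex^'n))"
  by (induction I rule: infinite_finite_induct) (simp_all add: matrix_vector_mult_add_rdistrib)

lemma poly_eq_sum_lessThan:
  fixes p :: "complex poly"
  assumes "degree p < m"
  shows "poly p x = (\<Sum>k<m. coeff p k * x ^ k)"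
  unfolding poly_altdef using assms
  by (intro sum.mono_neutral_left) (auto simp: coeff_eq_0)

lemma matrix_poly_eigenvector:
  assumes "N *v v = x *s v" "degree p < m"
  shows "matrix_poly m p N *v v = poly p x *s v"
proof -
  have "((**) N ^^ k) (Finite_Cartesian_Product.mat 1) *v v = x ^ k *s v" for k
    by (induction k) (simp_all add: matrix_vector_mul_assoc[symmetric] assms(1) vec.scale
        mult.commute)
  then show ?thesis
    by (simp add: matrix_poly_def sum_matrix_vector_mult matrix_vector_mul_assoc[symmetric]
        mat_mult_vector poly_eq_sum_lessThan[OF assms(2)] vec.scale_sum_left)
qed

text \<open>By Cramer's rule this is \<open>adj b \<cdot> a\<close>, a polynomial substitute for \<open>b\<^sup>-\<^sup>1 a\<close>.\<close>

definition cramer_matrix :: "complex^'n^'n \<Rightarrow> complex^'n^'n \<Rightarrow> complex^'n^'n" where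
  "cramer_matrix a b =
     (\<chi> k j. Determinants.det (\<chi> i l. if l = k then a $ i $ j else b $ i $ l))"

text \<open>Cramer's rule column by column: column j of \<open>c\<close> solves the system with
  matrix \<open>b\<close> and right-hand side column j of \<open>b ** c\<close>.\<close>

lemma cramer_matrix_mult: "cramer_matrix (b ** c) b = mat_scale (Determinants.det b) c"
proof -
  have "cramer_matrix (b ** c) b $ k $ j = c $ k $ j * Determinants.det b" for k j
    using cramer_lemma[of k b "\<chi> i. c $ i $ j"]
    by (simp add: cramer_matrix_def matrix_matrix_mult_def matrix_vector_mult_def cong: if_cong)
  then show ?thesis
    by (simp add: Finite_Cartesian_Product.vec_eq_iff mat_scale_def mult.commute)
qed

text \<open>
  With \<open>f\<close> the characteristic polynomial of \<open>N\<close>, the eigenvalues of \<open>f' N\<close> are the values of \<open>f'\<close>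
  at the roots of \<open>f\<close>.  So the last factor is the discriminant of \<open>f\<close> up to sign.
\<close>

definition pencil_discriminant :: "(complex^'n^'n) \<times> (complex^'n^'n) \<Rightarrow> complex" where
  "pencil_discriminant = (\<lambda>(a, b). let N = cramer_matrix a b in
     Determinants.det b * coeff (charpoly N) CARD('n) *
     Determinants.det (matrix_poly CARD('n) (pderiv (charpoly N)) N))"

lemma pencil_discriminant_polynomial:
  "pencil_discriminant \<in> polynomial_functions
     (module_prod.scale mat_scale (mat_scale :: complex \<Rightarrow> complex^'n^'n \<Rightarrow> complex^'n^'n))"
    (is "_ \<in> polynomial_functions ?s")
proof -
  interpret vector_space "mat_scale :: complex \<Rightarrow> complex^'n^'n \<Rightarrow> complex^'n^'n"
    by (rule vector_space_mat_scale)
  interpret P: vector_space_prod "mat_scale :: complex \<Rightarrow> complex^'n^'n \<Rightarrow> complex^'n^'n"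
    "mat_scale :: complex \<Rightarrow> complex^'n^'n \<Rightarrow> complex^'n^'n"
    by unfold_locales
  have entries: "(\<lambda>x. fst x $ i $ j) \<in> polynomial_functions ?s"
      "(\<lambda>x. snd x $ i $ j) \<in> polynomial_functions ?s" for i j
    by (auto intro!: polynomial_functions.functional simp: Vector_Spaces.linear_iff
        P.p.vector_space_axioms vector_space_over_itself.vector_space_axioms P.scale_def mat_scale_def)
  define N where "N x = cramer_matrix (fst x) (snd x)" for x :: "(complex^'n^'n) \<times> (complex^'n^'n)"
  have N: "(\<lambda>x. N x $ i $ j) \<in> polynomial_functions ?s" for i j
    unfolding N_def cramer_matrix_def vec_lambda_beta
    by (intro polynomial_functions_det) (auto intro: polynomial_functions_if entries)
  have "(\<lambda>x. - N x $ i $ j) \<in> polynomial_functions ?s" for i j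
    using polynomial_functions.mult[OF polynomial_functions.const[of "-1"] N] by simp
  then have char: "(\<lambda>x. coeff (charpoly (N x)) k) \<in> polynomial_functions ?s" for k
  proof -
    have "coeff [:x, y:] k = (if k = 0 then x else if k = 1 then y else 0)" for x y :: complex and k
      by (auto simp: coeff_pCons split: nat.splits)
    with \<open>\<And>i j. (\<lambda>x. - N x $ i $ j) \<in> polynomial_functions ?s\<close> show ?thesis
      unfolding charpoly_def
      by (intro polynomial_functions_coeff_det)
        (simp add: polynomial_functions_if polynomial_functions.const)
  qed
  have power: "(\<lambda>x. ((**) (N x) ^^ k) (Finite_Cartesian_Product.mat 1) $ i $ j)
      \<in> polynomial_functions ?s" for k i j
  proof (induction k arbitrary: i j)
    case 0
    then show ?case by (simp add: polynomial_functions.const)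
  next
    case (Suc k)
    then show ?case
      by (simp add: matrix_matrix_mult_def polynomial_functions_sum polynomial_functions.mult N)
  qed
  have "(\<lambda>x. matrix_poly m (pderiv (charpoly (N x))) (N x) $ i $ j) \<in> polynomial_functions ?s" for m i j
  proof -
    have "(\<lambda>x. (Finite_Cartesian_Product.mat (coeff (pderiv (charpoly (N x))) k) :: complex^'n^'n) $ i $ j)
        \<in> polynomial_functions ?s" for k i j
      by (auto simp: Finite_Cartesian_Product.mat_def coeff_pderiv
          intro!: polynomial_functions_if polynomial_functions.const polynomial_functions.mult char)
    then show ?thesis
      unfolding matrix_poly_def sum_component matrix_mult_nth
      by (intro polynomial_functions_sum polynomial_functions.mult power)
  qed
  then show ?thesis
    unfolding pencil_discriminant_def Let_def case_prod_beta N_def[symmetric]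
    by (intro polynomial_functions.mult polynomial_functions_det entries char)
qed

notation Finite_Cartesian_Product.transpose (\<open>(_\<^sup>t)\<close> [1000] 999)

text \<open>A common root of p and p' would have an eigenvector of \<open>N\<close> that p'(N)
  kills, against the determinant factor. So p has only simple roots, and over the complex numbers
  there are n of them.\<close>

lemma pencil_discriminant_nonzero:
  fixes a b :: "complex^'n^'n"
  assumes "pencil_discriminant (a, b) \<noteq> 0"
  obtains l v where "inj l" "\<And>i. v i \<noteq> 0" "\<And>i :: 'n. a *v v i = l i *s (b *v v i)"
proof -
  define N where "N = cramer_matrix a b"
  define p where "p = charpoly N"
  define n where "n = CARD('n)"
  have b: "Determinants.det b \<noteq> 0" and p_n: "coeff p n \<noteq> 0"
    and disc: "Determinants.det (matrix_poly n (pderiv p) N) \<noteq> 0"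
    using assms by (auto simp: pencil_discriminant_def Let_def N_def p_def n_def)
  have deg: "degree p = n"
    using p_n degree_charpoly_le[of N] le_degree[of p n] by (simp add: p_def n_def)
  \<comment> \<open>The index type is nonempty, so n is positive and p' has degree n - 1; truncation
    at n loses none of its coefficients.\<close>
  have "p \<noteq> 0" "degree (pderiv p) < n"
    using p_n by (auto simp: degree_pderiv deg n_def)
  have "poly (pderiv p) x \<noteq> 0" if "poly p x = 0" for x
  proof
    assume 0: "poly (pderiv p) x = 0"
    obtain v where v: "v \<noteq> 0" "N *v v = x *s v"
      using charpoly_root_eigenvector \<open>poly p x = 0\<close> unfolding p_def by blast
    have "matrix_poly n (pderiv p) N *v v = 0"
      using matrix_poly_eigenvector[OF v(2) \<open>degree (pderiv p) < n\<close>] 0 by simp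
    moreover have "invertible (matrix_poly n (pderiv p) N)"
      using disc by (simp add: invertible_det_nz)
    ultimately show False
      using v(1) matrix_left_invertible_ker invertible_left_inverse by blast
  qed
  then have "card {x. poly p x = 0} = CARD('n)"
    using rsquarefree_card_degree[OF \<open>p \<noteq> 0\<close>] deg by (auto simp: rsquarefree_roots n_def)
  then obtain l where l: "bij_betw l (UNIV :: 'n set) {x. poly p x = 0}"
    using finite_same_card_bij[of "UNIV :: 'n set" "{x. poly p x = 0}"]
      poly_roots_finite[OF \<open>p \<noteq> 0\<close>] by auto
  have "\<exists>v. v \<noteq> 0 \<and> N *v v = l i *s v" for i
    using charpoly_root_eigenvector[of N "l i"] bij_betwE[OF l] unfolding p_def by blast
  then obtain v where v: "\<And>i. v i \<noteq> 0" "\<And>i. N *v v i = l i *s v i"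
    by metis
  obtain b' where b': "b ** b' = Finite_Cartesian_Product.mat 1"
    using b invertible_det_nz invertible_right_inverse by blast
  \<comment> \<open>This factorization puts \<open>a\<close> in the shape required by
    \<open>cramer_matrix_mult\<close>.\<close>
  have "a = b ** (b' ** a)"
    by (simp add: matrix_mul_assoc b')
  then have N: "N = mat_scale (Determinants.det b) (b' ** a)"
    using cramer_matrix_mult unfolding N_def by metis
  \<comment> \<open>Dividing by \<open>det b\<close> turns eigenvalues of \<open>N\<close> into
    those of the pair (a, b).\<close>
  have "a *v v i = (l i / Determinants.det b) *s (b *v v i)" for i
  proof -
    have "Determinants.det b *s (a *v v i) = b *v (Determinants.det b *s ((b' ** a) *v v i))"
      by (simp add: vec.scale matrix_vector_mul_assoc matrix_mul_assoc b')
    also have "Determinants.det b *s ((b' ** a) *v v i) = N *v v i"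
      by (simp add: N mat_scale_def Finite_Cartesian_Product.vec_eq_iff matrix_vector_mult_def
          sum_distrib_left mult.assoc)
    also have "b *v (N *v v i) = l i *s (b *v v i)"
      by (simp add: v vec.scale)
    finally have "(1 / Determinants.det b) *s (Determinants.det b *s (a *v v i))
        = (1 / Determinants.det b) *s (l i *s (b *v v i))"
      by simp
    then show ?thesis
      using b by (simp add: vector_smult_assoc)
  qed
  moreover have "inj (\<lambda>i. l i / Determinants.det b)"
    using l b by (auto simp: bij_betw_def inj_on_def)
  ultimately show ?thesis
    using that v(1) by blast
qed

lemma pencil_discriminant_det: "pencil_discriminant (a, b) \<noteq> 0 \<Longrightarrow> Determinants.det b \<noteq> 0"
  by (auto simp: pencil_discriminant_def Let_def)

section \<open>Simultaneous diagonalization by congruence\<close>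

text \<open>Applying a - l_k b to a relation removes the term of v_k and multiplies the others by
  l_i - l_k. Cancelling \<open>b\<close> leaves a shorter relation, to which induction
  applies.\<close>

lemma generalized_eigenvectors_independent:
  fixes a b :: "complex^'n^'n"
  assumes b: "invertible b" and "inj l" and v: "\<And>i. v i \<noteq> 0"
    and eigen: "\<And>i. a *v v i = l i *s (b *v v i)"
    and "finite I" "(\<Sum>i\<in>I. c i *s v i) = 0" "i \<in> I"
  shows "c i = 0"
  using assms(5-7)
proof (induction I arbitrary: c i rule: finite_induct)
  case (insert k I)
  have 0: "(\<Sum>i\<in>insert k I. c i *s v i) = 0"
    by (fact insert.prems(1))
  have "b *v (\<Sum>i\<in>insert k I. (c i * (l i - l k)) *s v i)
      = a *v (\<Sum>i\<in>insert k I. c i *s v i) - l k *s (b *v (\<Sum>i\<in>insert k I. c i *s v i))"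
    by (simp only: vec.sum vec.scale eigen vec.scale_sum_right vector_smult_assoc
        sum_subtractf[symmetric])
      (simp add: vec.scale_left_diff_distrib algebra_simps)
  also have "\<dots> = 0"
    by (simp only: 0) simp
  finally have "(\<Sum>i\<in>insert k I. (c i * (l i - l k)) *s v i) = 0"
    using b matrix_left_invertible_ker invertible_left_inverse by blast
  then have "(\<Sum>i\<in>I. (c i * (l i - l k)) *s v i) = 0"
    using insert.hyps by simp
  then have I: "c i = 0" if "i \<in> I" for i
    using insert.IH[of "\<lambda>i. c i * (l i - l k)" i] insert.hyps that \<open>inj l\<close>
    by (auto dest: injD)
  then have "c k *s v k = 0"
    using 0 insert.hyps by simp
  then have "c k = 0"
    using v[of k] by simp
  with I insert.prems(2) show ?case
    by auto
qed simp

lemma diagonal_matrix_mult: "diagonal_matrix c ** diagonal_matrix d = diagonal_matrix (\<lambda>i. c i * d i)"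
  by (simp add: Finite_Cartesian_Product.vec_eq_iff matrix_matrix_mult_def
      if_distrib[of "\<lambda>x. x * _"] if_distrib[of "\<lambda>x. _ * x"] cong: if_cong)

lemma matrix_diagonal_mult_nth:
  "(A ** diagonal_matrix d) $ i $ j = A $ i $ j * d j" "(diagonal_matrix d ** A) $ i $ j = d i * A $ i $ j"
  by (simp_all add: matrix_matrix_mult_def
      if_distrib[of "\<lambda>x. x * _"] if_distrib[of "\<lambda>x. _ * x"] cong: if_cong)

lemma transpose_diagonal_matrix: "(diagonal_matrix d)\<^sup>t = diagonal_matrix d"
  by (simp add: Finite_Cartesian_Product.vec_eq_iff Finite_Cartesian_Product.transpose_def)

text \<open>For the matrix P of eigenvectors, both G = P^T b P and G D = P^T a P are symmetric.
  Hence G commutes with D, and the distinct entries of D force G to be diagonal.\<close>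

lemma simultaneous_congruence_diagonalization:
  fixes a b :: "complex^'n^'n"
  assumes "a \<in> symmetric_forms" "b \<in> symmetric_forms" and b: "Determinants.det b \<noteq> 0"
    and "inj l" and v: "\<And>i. v i \<noteq> 0" and eigen: "\<And>i. a *v v i = l i *s (b *v v i)"
  obtains Q where "Determinants.det Q \<noteq> 0" "a = Q ** diagonal_matrix l ** Q\<^sup>t" "b = Q ** Q\<^sup>t"
proof -
  define P where "P = (\<chi> i j. v j $ i)"
  have symmetric: "a\<^sup>t = a" "b\<^sup>t = b"
    using assms(1,2) by (simp_all add: symmetric_forms_def)
  have column: "Finite_Cartesian_Product.column i P = v i" for i
    by (simp add: P_def Finite_Cartesian_Product.column_def Finite_Cartesian_Product.vec_eq_iff)
  have "\<exists>B. B ** P = Finite_Cartesian_Product.mat 1"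
    unfolding matrix_left_invertible_independent_columns column
    using generalized_eigenvectors_independent[OF _ \<open>inj l\<close> v eigen finite] b
    by (auto simp: invertible_det_nz)
  then obtain P' where P': "P' ** P = Finite_Cartesian_Product.mat 1"
    "P ** P' = Finite_Cartesian_Product.mat 1"
    using matrix_left_right_inverse by blast
  have P't: "P'\<^sup>t ** P\<^sup>t = Finite_Cartesian_Product.mat 1"
    by (metis P'(2) matrix_transpose_mul transpose_mat)
  have aP: "a ** P = b ** P ** diagonal_matrix l"
  proof -
    have "(a ** P) $ i $ j = (a *v v j) $ i" "(b ** P) $ i $ j = (b *v v j) $ i" for i j
      by (simp_all add: P_def matrix_matrix_mult_def matrix_vector_mult_def)
    then show ?thesis
      by (simp add: Finite_Cartesian_Product.vec_eq_iff matrix_diagonal_mult_nth eigen mult.commute)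
  qed
  define G where "G = P\<^sup>t ** b ** P"
  have PaP: "P\<^sup>t ** a ** P = G ** diagonal_matrix l"
    by (simp add: G_def matrix_mul_assoc[symmetric] aP)
  have G: "G\<^sup>t = G"
    by (simp add: G_def matrix_transpose_mul symmetric matrix_mul_assoc)
  have "(P\<^sup>t ** a ** P)\<^sup>t = P\<^sup>t ** a ** P"
    by (simp add: matrix_transpose_mul symmetric matrix_mul_assoc)
  then have "diagonal_matrix l ** G = G ** diagonal_matrix l"
    unfolding PaP by (simp add: matrix_transpose_mul G transpose_diagonal_matrix)
  then have "l i * G $ i $ j = G $ i $ j * l j" for i j
    by (metis matrix_diagonal_mult_nth)
  then have off: "G $ i $ j = 0" if "i \<noteq> j" for i j
    using that \<open>inj l\<close> by (metis injD mult.commute mult_cancel_left)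
  define r where "r i = csqrt (G $ i $ i)" for i
  have r: "r i * r i = G $ i $ i" for i
    by (metis r_def power2_csqrt power2_eq_square)
  have G_diag: "G = diagonal_matrix (\<lambda>i. r i * r i)"
    using off by (auto simp: Finite_Cartesian_Product.vec_eq_iff r)
  \<comment> \<open>Since b is P'^T G P', half of G = r^2 goes to each side. Complex square roots
    exist, and r never has to be inverted.\<close>
  define Q where "Q = P'\<^sup>t ** diagonal_matrix r"
  have Qt: "Q\<^sup>t = diagonal_matrix r ** P'"
    by (simp add: Q_def matrix_transpose_mul transpose_diagonal_matrix)
  have undo: "P'\<^sup>t ** (P\<^sup>t ** c ** P) ** P' = c" for c
    by (metis P'(2) P't matrix_mul_assoc matrix_mul_lid matrix_mul_rid)
  have "Q ** diagonal_matrix l ** Q\<^sup>t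
      = P'\<^sup>t ** (diagonal_matrix r ** diagonal_matrix l ** diagonal_matrix r) ** P'"
    unfolding Qt unfolding Q_def by (simp add: matrix_mul_assoc)
  also have "diagonal_matrix r ** diagonal_matrix l ** diagonal_matrix r = G ** diagonal_matrix l"
    by (simp add: G_diag diagonal_matrix_mult mult_ac)
  finally have 1: "a = Q ** diagonal_matrix l ** Q\<^sup>t"
    by (simp add: undo flip: PaP)
  have "Q ** Q\<^sup>t = P'\<^sup>t ** (diagonal_matrix r ** diagonal_matrix r) ** P'"
    unfolding Qt unfolding Q_def by (simp add: matrix_mul_assoc)
  also have "diagonal_matrix r ** diagonal_matrix r = G"
    by (simp add: G_diag diagonal_matrix_mult)
  finally have 2: "b = Q ** Q\<^sup>t"
    by (simp add: undo G_def)
  have "Determinants.det Q \<noteq> 0"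
    using b by (auto simp: 2 det_mul)
  with 1 2 that show ?thesis
    by blast
qed

section \<open>A point where the discriminant does not vanish\<close>

lemma matrix_power_diagonal:
  "((**) (diagonal_matrix l) ^^ k) (Finite_Cartesian_Product.mat 1) = diagonal_matrix (\<lambda>i. l i ^ k)"
proof (induction k)
  case 0
  then show ?case
    by (simp add: Finite_Cartesian_Product.vec_eq_iff Finite_Cartesian_Product.mat_def)
next
  case (Suc k)
  then show ?case
    by (simp add: diagonal_matrix_mult)
qed

text \<open>This serves to show that the open set is nonempty. With \<open>b\<close> the identity, N
  is the diagonal matrix itself and p'(N) is diagonal with entries p'(l_i), nonzero because the
  roots of p are simple.\<close>

lemma pencil_discriminant_diagonal:
  fixes l :: "'n::finite \<Rightarrow> complex"
  assumes "inj l"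
  shows "pencil_discriminant (diagonal_matrix l, Finite_Cartesian_Product.mat 1) \<noteq> 0"
proof -
  define p where "p = (\<Prod>i\<in>UNIV. [:- l i, 1:])"
  define n where "n = CARD('n)"
  have N: "cramer_matrix (diagonal_matrix l) (Finite_Cartesian_Product.mat 1) = diagonal_matrix l"
    using cramer_matrix_mult[of "Finite_Cartesian_Product.mat 1" "diagonal_matrix l"]
    by (simp add: mat_scale_def Finite_Cartesian_Product.vec_eq_iff)
  have char: "charpoly (diagonal_matrix l) = p"
    unfolding charpoly_def p_def by (subst det_diagonal) auto
  have deg: "degree p = n"
    unfolding p_def n_def by (subst degree_prod_eq_sum_degree) auto
  moreover have "lead_coeff p = 1"
    unfolding p_def by (simp add: lead_coeff_prod)
  ultimately have p_n: "coeff p n = 1"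
    by simp
  then have "p \<noteq> 0"
    by auto
  have roots: "{x. poly p x = 0} = range l"
    by (auto simp: p_def poly_prod)
  then have "rsquarefree p"
    using rsquarefree_card_degree[OF \<open>p \<noteq> 0\<close>] \<open>inj l\<close> deg by (simp add: card_image n_def)
  then have p': "poly (pderiv p) (l i) \<noteq> 0" for i
    using roots by (auto simp: rsquarefree_roots)
  have "degree (pderiv p) < n"
    by (simp add: degree_pderiv deg n_def)
  then have "matrix_poly n (pderiv p) (diagonal_matrix l) = diagonal_matrix (\<lambda>i. poly (pderiv p) (l i))"
    unfolding matrix_poly_def matrix_power_diagonal
    by (simp add: poly_eq_sum_lessThan Finite_Cartesian_Product.vec_eq_iff
        matrix_diagonal_mult_nth Finite_Cartesian_Product.mat_def)
  then have "Determinants.det (matrix_poly n (pderiv p) (diagonal_matrix l)) \<noteq> 0"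
    using p' by (simp add: det_diagonal)
  with p_n show ?thesis
    by (simp add: pencil_discriminant_def Let_def N char n_def)
qed

section \<open>Invariance of the type under congruence\<close>

lemma matrix_mult_add_distrib_right:
  fixes A B :: "complex^'m^'n"
  shows "(A + B) ** C = A ** C + B ** C"
  by (simp add: Finite_Cartesian_Product.vec_eq_iff matrix_matrix_mult_def distrib_right sum.distrib)

text \<open>Covers both the conjugation on gl(V) and the congruence on symmetric forms.\<close>

lemma linear_matrix_sandwich:
  fixes P R :: "complex^'n^'n"
  shows "Vector_Spaces.linear mat_scale mat_scale (\<lambda>X. P ** X ** R)"
proof -
  have "P ** mat_scale c X = mat_scale c (P ** X)" "mat_scale c X ** R = mat_scale c (X ** R)"
    for c and X :: "complex^'n^'n"
    by (simp_all add: Finite_Cartesian_Product.vec_eq_iff mat_scale_def matrix_matrix_mult_def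
        sum_distrib_left mult_ac)
  then show ?thesis
    by (simp add: Vector_Spaces.linear_iff vector_space_mat_scale matrix_add_ldistrib
        matrix_mult_add_distrib_right)
qed

lemma matrix_left_cancel:
  "P ** Q = Finite_Cartesian_Product.mat 1 \<Longrightarrow> P ** (Q ** X) = (X :: complex^'m^'n)"
  by (simp add: matrix_mul_assoc)

lemma congruence_rep_conjugate:
  fixes Q :: "complex^'n^'n"
  assumes "Q' ** Q = Finite_Cartesian_Product.mat 1"
  shows "congruence_rep (Q ** X ** Q') (Q ** c ** Q\<^sup>t) = Q ** congruence_rep X c ** Q\<^sup>t"
proof -
  have "Q\<^sup>t ** Q'\<^sup>t = Finite_Cartesian_Product.mat 1"
    by (metis assms matrix_transpose_mul transpose_mat)
  then have "Q ** X ** Q' ** (Q ** c ** Q\<^sup>t) = Q ** (X ** c) ** Q\<^sup>t"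
    "Q ** c ** Q\<^sup>t ** (Q ** X ** Q')\<^sup>t = Q ** (c ** X\<^sup>t) ** Q\<^sup>t"
    using assms
    by (simp_all add: matrix_transpose_mul matrix_mul_assoc[symmetric] matrix_left_cancel)
  then show ?thesis
    by (simp add: congruence_rep_def matrix_add_ldistrib matrix_mult_add_distrib_right)
qed

lemma has_algebraic_type_congruent:
  fixes Q :: "complex^'n^'n"
  assumes "Determinants.det Q \<noteq> 0"
    and "has_algebraic_type mat_scale UNIV mat_scale symmetric_forms
           (orbit_map congruence_rep a) (orbit_map congruence_rep b) \<tau>"
  shows "has_algebraic_type mat_scale UNIV mat_scale symmetric_forms
           (orbit_map congruence_rep (Q ** a ** Q\<^sup>t)) (orbit_map congruence_rep (Q ** b ** Q\<^sup>t)) \<tau>"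
proof -
  obtain Q' where Q': "Q' ** Q = Finite_Cartesian_Product.mat 1" "Q ** Q' = Finite_Cartesian_Product.mat 1"
    using assms(1) unfolding invertible_det_nz[symmetric] invertible_def by blast
  have Qt: "Q'\<^sup>t ** Q\<^sup>t = Finite_Cartesian_Product.mat 1" "Q\<^sup>t ** Q'\<^sup>t = Finite_Cartesian_Product.mat 1"
    by (metis Q' matrix_transpose_mul transpose_mat)+
  let ?\<phi> = "\<lambda>X. Q ** X ** Q'" and ?\<psi> = "\<lambda>X. Q ** X ** Q\<^sup>t"
  have \<phi>: "Q' ** ?\<phi> X ** Q = X" "?\<phi> (Q' ** X ** Q) = X"
    and \<psi>: "Q' ** ?\<psi> X ** Q'\<^sup>t = X" "?\<psi> (Q' ** X ** Q'\<^sup>t) = X" for X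
    by (simp_all add: Q' Qt matrix_mul_assoc[symmetric] matrix_left_cancel)
  have inj: "inj ?\<phi>" "inj ?\<psi>"
    by (rule inj_on_inverseI[where g = "\<lambda>X. Q' ** X ** Q"], rule \<phi>(1),
        rule inj_on_inverseI[where g = "\<lambda>X. Q' ** X ** Q'\<^sup>t"], rule \<psi>(1))
  have img1: "?\<phi> ` UNIV = UNIV"
    by (rule surjI) (rule \<phi>(2))
  \<comment> \<open>Congruence by the inverse \<open>Q'\<close> preserves symmetry as well, which
    gives the reverse inclusion.\<close>
  have img2: "?\<psi> ` symmetric_forms = symmetric_forms"
  proof -
    have sym: "P ** X ** P\<^sup>t \<in> symmetric_forms" if "X \<in> symmetric_forms" for P X :: "complex^'n^'n"
      using that by (simp add: symmetric_forms_def matrix_transpose_mul matrix_mul_assoc)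
    show ?thesis
    proof
      show "?\<psi> ` symmetric_forms \<subseteq> symmetric_forms"
        using sym by auto
      show "symmetric_forms \<subseteq> ?\<psi> ` symmetric_forms"
      proof
        fix X :: "complex^'n^'n" assume "X \<in> symmetric_forms"
        then have "Q' ** X ** Q'\<^sup>t \<in> symmetric_forms"
          by (rule sym)
        then show "X \<in> ?\<psi> ` symmetric_forms"
          using \<psi>(2)[of X] by (intro image_eqI[of _ _ "Q' ** X ** Q'\<^sup>t"]) simp_all
      qed
    qed
  qed
  have equivariant: "orbit_map congruence_rep (?\<psi> c) (?\<phi> X) = ?\<psi> (orbit_map congruence_rep c X)" for c X
    unfolding orbit_map_def by (rule congruence_rep_conjugate[OF Q'(1)])
  obtain bs where type: "type_of_blocks bs = \<tau>"
    and form: "has_kronecker_form mat_scale UNIV mat_scale symmetric_forms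
      (orbit_map congruence_rep a) (orbit_map congruence_rep b) bs"
    using assms(2) unfolding has_algebraic_type_def by blast
  have "has_kronecker_form mat_scale (?\<phi> ` UNIV) mat_scale (?\<psi> ` symmetric_forms)
      (orbit_map congruence_rep (?\<psi> a)) (orbit_map congruence_rep (?\<psi> b)) bs"
    by (rule has_kronecker_form_image[OF linear_matrix_sandwich inj(1) linear_matrix_sandwich inj(2)
          equivariant equivariant form])
  with type show ?thesis
    unfolding img1 img2 has_algebraic_type_def by blast
qed

theorem theorem4p1:
  shows "has_JK_invariants mat_scale UNIV mat_scale symmetric_forms
           (congruence_rep :: complex^'n^'n \<Rightarrow> complex^'n^'n \<Rightarrow> complex^'n^'n)
           \<lparr> jordan_sizes = replicate_mset CARD('n) {#1#},
             horizontal_indices = replicate_mset (CARD('n) * (CARD('n) - 1) div 2) 2,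
             vertical_indices = {#} \<rparr>"
proof -
  let ?W = "symmetric_forms :: (complex^'n^'n) set"
  let ?S = "{x \<in> ?W \<times> ?W. \<exists>p\<in>{pencil_discriminant}. p x \<noteq> 0}"
  have I: "(Finite_Cartesian_Product.mat 1 :: complex^'n^'n) = diagonal_matrix (\<lambda>_. 1)"
    by (simp add: Finite_Cartesian_Product.vec_eq_iff Finite_Cartesian_Product.mat_def)
  have diagonal_symmetric: "diagonal_matrix d \<in> ?W" for d
    by (simp add: symmetric_forms_def transpose_diagonal_matrix)
  \<comment> \<open>An injection into the naturals supplies distinct diagonal entries, and so a
    point of \<open>?S\<close>.\<close>
  obtain g :: "'n \<Rightarrow> nat" where "inj g"
    using finite_imp_inj_to_nat_seg[of "UNIV :: 'n set"] by auto
  then have "inj (\<lambda>i. of_nat (g i) :: complex)"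
    by (simp add: inj_on_def)
  then have "pencil_discriminant (diagonal_matrix (\<lambda>i. of_nat (g i)), Finite_Cartesian_Product.mat 1) \<noteq> 0"
    by (rule pencil_discriminant_diagonal)
  moreover have "Finite_Cartesian_Product.mat 1 \<in> ?W"
    by (simp add: I diagonal_symmetric)
  ultimately have "(diagonal_matrix (\<lambda>i. of_nat (g i)), Finite_Cartesian_Product.mat 1) \<in> ?S"
    using diagonal_symmetric by simp
  moreover have "zariski_open_in (module_prod.scale mat_scale mat_scale) (?W \<times> ?W) ?S"
    unfolding zariski_open_in_def using pencil_discriminant_polynomial
    by (intro exI[of _ "{pencil_discriminant}"]) simp
  moreover have "has_algebraic_type mat_scale UNIV mat_scale ?W
      (orbit_map congruence_rep a) (orbit_map congruence_rep b)
      \<lparr> jordan_sizes = replicate_mset CARD('n) {#1#},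
        horizontal_indices = replicate_mset (CARD('n) * (CARD('n) - 1) div 2) 2,
        vertical_indices = {#} \<rparr>" if "(a, b) \<in> ?S" for a b
  proof -
    have sym: "a \<in> ?W" "b \<in> ?W" and disc: "pencil_discriminant (a, b) \<noteq> 0"
      using that by auto
    obtain l :: "'n \<Rightarrow> complex" and v where l: "inj l" "\<And>i. v i \<noteq> 0" "\<And>i. a *v v i = l i *s (b *v v i)"
      using pencil_discriminant_nonzero[OF disc] by blast
    obtain Q where Q: "Determinants.det Q \<noteq> 0" "a = Q ** diagonal_matrix l ** Q\<^sup>t" "b = Q ** Q\<^sup>t"
      using simultaneous_congruence_diagonalization[OF sym pencil_discriminant_det[OF disc] l] by blast
    have "b = Q ** diagonal_matrix (\<lambda>_. 1) ** Q\<^sup>t"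
      by (simp add: Q flip: I)
    then show ?thesis
      using has_algebraic_type_congruent[OF Q(1) has_algebraic_type_diagonal[OF l(1)]] Q(2) by simp
  qed
  ultimately show ?thesis
    unfolding has_JK_invariants_def by (intro exI[of _ ?S] conjI) blast+
qed

end
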